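(* For an integer $k\ge2$, let $\mathcal{G}_k$ denote the set of all simple graphs on $k$ vertices with no isolated vertices. If $2\le n\le m$, then \[ \max_{F\in\mathcal{G}_n,\ G\in\mathcal{G}_m}\mathcal{RH}(F,G)=\begin{cases}\frac{m}{2}-1 & n=2,\\[2pt] \frac{m^2}{2m+1}-1 & n\ge3,\ m\ge4.\end{cases}\]
   Context: For a graph $H$ without isolated vertices, $\Delta(H)$ is its maximum degree, $f_H(k)=|\{v: d(v)\ge k\}|$ for integers $k\ge1$, and the smooth ccdh is the piecewise-linear interpolation $\varphi_H(x)=(1-(x-\lfloor x\rfloor))f_H(\lfloor x\rfloor)+(x-\lfloor x\rfloor)f_H(\lfloor x\rfloor+1)$ for real $x\ge1$. The smooth directional Relative Hausdorff distance $\mathcal{RH}_r(F,G)$ is the minimum $\epsilon\ge0$ such that for every integer $d\in\{1,\dots,\Delta(F)\}$ there is a real $d'\in[1,\Delta(G)+1]$ with $|d-d'|\le\epsilon d$ and $|\varphi_F(d)-\varphi_G(d')|\le\epsilon\varphi_F(d)$; and $\mathcal{RH}(F,G)=\max\{\mathcal{RH}_r(F,G),\mathcal{RH}_r(G,F)\}$. *)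

theory Defs
  imports "HOL-Analysis.Analysis" "Graph_Theory.Graph_Theory"
begin

text \<open>
  Finite simple graphs are rendered by the locale \<^locale>\<open>pair_graph\<close>: finite, loop-free and
  symmetric, each undirected edge being represented by its two orientations. Hence the number of
  arcs leaving a vertex is its degree in the undirected graph.
\<close>

definition deg :: "'a pair_pre_digraph \<Rightarrow> 'a \<Rightarrow> nat" where
  "deg H v = out_degree (with_proj H) v"

definition max_deg :: "'a pair_pre_digraph \<Rightarrow> nat" where
  "max_deg H = Max (deg H ` pverts H)"

text \<open>The vertex sets range over all \<open>k\<close>-element sets of natural numbers, so every isomorphism
  class of graphs on \<open>k\<close> vertices without isolated vertices is represented.\<close>

definition graphs_on :: "nat \<Rightarrow> nat pair_pre_digraph set" where
  "graphs_on k = {H. pair_graph H \<and> card (pverts H) = k \<and> (\<forall>v \<in> pverts H. deg H v \<noteq> 0)}"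

definition ccdh :: "'a pair_pre_digraph \<Rightarrow> nat \<Rightarrow> nat" where
  "ccdh H k = card {v \<in> pverts H. deg H v \<ge> k}"

text \<open>Only meaningful for \<open>x \<ge> 1\<close>; there \<open>nat \<lfloor>x\<rfloor>\<close> does not truncate.\<close>

definition smooth_ccdh :: "'a pair_pre_digraph \<Rightarrow> real \<Rightarrow> real" where
  "smooth_ccdh H x =
     (1 - (x - of_int \<lfloor>x\<rfloor>)) * real (ccdh H (nat \<lfloor>x\<rfloor>))
     + (x - of_int \<lfloor>x\<rfloor>) * real (ccdh H (nat \<lfloor>x\<rfloor> + 1))"

definition RH_within :: "'a pair_pre_digraph \<Rightarrow> 'b pair_pre_digraph \<Rightarrow> real \<Rightarrow> bool" where
  "RH_within F G \<epsilon> \<longleftrightarrow>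
     (\<forall>d \<in> {1..max_deg F}. \<exists>d' \<in> {1..real (max_deg G) + 1}.
        \<bar>real d - d'\<bar> \<le> \<epsilon> * real d \<and>
        \<bar>smooth_ccdh F (real d) - smooth_ccdh G d'\<bar> \<le> \<epsilon> * smooth_ccdh F (real d))"

definition RH_dir :: "'a pair_pre_digraph \<Rightarrow> 'b pair_pre_digraph \<Rightarrow> real" where
  "RH_dir F G = (LEAST \<epsilon>. \<epsilon> \<ge> 0 \<and> RH_within F G \<epsilon>)"

definition RH :: "'a pair_pre_digraph \<Rightarrow> 'b pair_pre_digraph \<Rightarrow> real" where
  "RH F G = max (RH_dir F G) (RH_dir G F)"

definition is_maximum :: "'a::linorder set \<Rightarrow> 'a \<Rightarrow> bool" where
  "is_maximum S a \<longleftrightarrow> a \<in> S \<and> (\<forall>s \<in> S. s \<le> a)"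

end

theory Submission
  imports Defs
begin

text \<open>
  The smooth ccdh is \<open>\<phi>\<^sub>H(x) = \<Sum>\<^sub>v max 0 (min 1 (d(v) + 1 - x))\<close>, hence continuous and
  decreasing, and the minimum defining the directional distance is attained.

  Let \<open>c = m\<^sup>2 / (2m + 1)\<close>, so that \<open>m (m - 2c) = c\<close>. For \<open>n \<ge> 3\<close> and a point \<open>(d, a)\<close> of the ccdh of
  \<open>F\<close>, either \<open>a \<ge> 3\<close>, and then \<open>\<phi>\<^sub>G \<le> m \<le> c a\<close> everywhere, or \<open>d \<ge> 2\<close>, and then
  \<open>\<phi>\<^sub>G(c d) \<le> m (m - 2c) = c \<le> c a\<close>. So the intermediate value theorem on \<open>[1, c d]\<close> yields a point
  at relative distance at most \<open>c - 1\<close>. The point \<open>(2, 1)\<close> of a star against the complete graph on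
  \<open>m\<close> vertices shows that \<open>c\<close> is optimal.
\<close>

section \<open>Degrees\<close>

lemma deg_conv_card: "deg H v = card {w. (v, w) \<in> parcs H}"
proof -
  have "out_arcs (with_proj H) v = Pair v ` {w. (v, w) \<in> parcs H}"
    by (auto simp: out_arcs_def)
  then show ?thesis
    by (simp add: deg_def out_degree_def card_image inj_on_def)
qed

text \<open>Without loops, \<open>v\<close> is missing from its own neighbourhood, so that set is a
  proper subset of the vertices.\<close>

lemma (in pair_graph) deg_less_card:
  assumes "v \<in> pverts G"
  shows "deg G v < card (pverts G)"
proof -
  have "{w. (v, w) \<in> parcs G} \<subset> pverts G"
    using assms pair_no_loops[of "(v, v)"] by (auto dest: in_arcsD2)
  then show ?thesis
    unfolding deg_conv_card using pair_finite_verts by (rule psubset_card_mono[rotated])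
qed

lemma graphs_onD:
  assumes "H \<in> graphs_on k"
  shows "finite (pverts H)" "card (pverts H) = k"
    "\<And>v. v \<in> pverts H \<Longrightarrow> 1 \<le> deg H v" "\<And>v. v \<in> pverts H \<Longrightarrow> deg H v < k"
proof -
  interpret pair_graph H using assms by (simp add: graphs_on_def)
  show "finite (pverts H)" by (rule pair_finite_verts)
  show "card (pverts H) = k" using assms by (simp add: graphs_on_def)
  show "1 \<le> deg H v" if "v \<in> pverts H" for v
    using assms that by (simp add: graphs_on_def Suc_le_eq)
  show "deg H v < k" if "v \<in> pverts H" for v
    using assms deg_less_card[OF that] by (simp add: graphs_on_def)
qed

lemma deg_le_max_deg:
  assumes "finite (pverts H)" "v \<in> pverts H"
  shows "deg H v \<le> max_deg H"
  using assms by (simp add: max_deg_def)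

lemma max_deg_attained:
  assumes "finite (pverts H)" "pverts H \<noteq> {}"
  obtains v where "v \<in> pverts H" "deg H v = max_deg H"
proof -
  have "max_deg H \<in> deg H ` pverts H"
    unfolding max_deg_def using assms by (intro Max_in) auto
  then show thesis using that by force
qed

lemma max_deg_graphs_on:
  assumes "H \<in> graphs_on k" "2 \<le> k"
  shows "1 \<le> max_deg H" "max_deg H < k"
proof -
  have "pverts H \<noteq> {}" using graphs_onD(2)[OF assms(1)] assms(2) by auto
  then obtain v where "v \<in> pverts H" "deg H v = max_deg H"
    using max_deg_attained graphs_onD(1)[OF assms(1)] by blast
  then show "1 \<le> max_deg H" "max_deg H < k"
    using graphs_onD(3,4)[OF assms(1)] by metis+
qed

section \<open>The smooth ccdh\<close>

lemma ccdh_le_card: "finite (pverts H) \<Longrightarrow> ccdh H d \<le> card (pverts H)"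
  unfolding ccdh_def by (intro card_mono) auto

lemma ccdh_pos:
  assumes "finite (pverts H)" "pverts H \<noteq> {}" "d \<le> max_deg H"
  shows "0 < ccdh H d"
proof -
  obtain v where "v \<in> pverts H" "deg H v = max_deg H"
    using max_deg_attained assms(1,2) by blast
  then have "{v \<in> pverts H. d \<le> deg H v} \<noteq> {}" using assms(3) by auto
  then show ?thesis using assms(1) by (simp add: ccdh_def card_gt_0_iff)
qed

lemma ccdh_one: "H \<in> graphs_on k \<Longrightarrow> ccdh H 1 = k"
proof -
  assume H: "H \<in> graphs_on k"
  have "{v \<in> pverts H. 1 \<le> deg H v} = pverts H" using graphs_onD(3)[OF H] by blast
  then show "ccdh H 1 = k" using graphs_onD(2)[OF H] by (simp add: ccdh_def)
qed

lemma smooth_ccdh_of_nat [simp]: "smooth_ccdh H (real d) = real (ccdh H d)"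
  by (simp add: smooth_ccdh_def)

lemma ccdh_conv_sum:
  assumes "finite (pverts H)"
  shows "real (ccdh H k) = (\<Sum>v\<in>pverts H. if k \<le> deg H v then 1 else 0)"
  using assms by (simp add: ccdh_def sum.If_cases Int_def)

text \<open>Interpolation is linear, so it can be done vertex by vertex: the indicator of
  \<open>k \<le> deg H v\<close> becomes a ramp in x that falls from 1 at \<open>deg H v\<close> to
  0 at \<open>deg H v + 1\<close>.\<close>

lemma smooth_ccdh_conv_sum:
  assumes "finite (pverts H)" "0 \<le> x"
  shows "smooth_ccdh H x = (\<Sum>v\<in>pverts H. max 0 (min 1 (real (deg H v) + 1 - x)))"
proof -
  define k where "k = nat \<lfloor>x\<rfloor>"
  have fl: "real_of_int \<lfloor>x\<rfloor> = real k" using assms(2) by (simp add: k_def)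
  have x: "real k \<le> x" "x < real k + 1" using fl by linarith+
  have "smooth_ccdh H x = (\<Sum>v\<in>pverts H. (1 - (x - real k)) * (if k \<le> deg H v then 1 else 0)
      + (x - real k) * (if k + 1 \<le> deg H v then 1 else 0))"
    unfolding smooth_ccdh_def fl k_def[symmetric] ccdh_conv_sum[OF assms(1)]
    by (simp only: sum.distrib sum_distrib_left)
  also have "\<dots> = (\<Sum>v\<in>pverts H. max 0 (min 1 (real (deg H v) + 1 - x)))"
  proof (rule sum.cong[OF refl])
    fix v
    consider "deg H v < k" | "deg H v = k" | "k + 1 \<le> deg H v" by linarith
    then show "(1 - (x - real k)) * (if k \<le> deg H v then 1 else 0)
      + (x - real k) * (if k + 1 \<le> deg H v then 1 else 0)
      = max 0 (min 1 (real (deg H v) + 1 - x))"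
    proof cases
      case 1
      then have "real (deg H v) + 1 \<le> real k" by linarith
      with 1 x show ?thesis by simp
    next
      case 2
      with x show ?thesis by simp
    next
      case 3
      then have "real k + 1 \<le> real (deg H v)" by linarith
      with 3 x show ?thesis by simp
    qed
  qed
  finally show ?thesis .
qed

lemma continuous_on_smooth_ccdh:
  assumes "finite (pverts H)"
  shows "continuous_on {0..} (smooth_ccdh H)"
proof -
  have "continuous_on {0..} (\<lambda>x. \<Sum>v\<in>pverts H. max 0 (min 1 (real (deg H v) + 1 - x)))"
    by (intro continuous_intros)
  then show ?thesis
    by (rule continuous_on_cong[THEN iffD1, rotated 2])
      (auto simp: smooth_ccdh_conv_sum[OF assms])
qed

text \<open>Every ramp has reached 0 at this point. It is the right end of the range of
  \<open>d'\<close>, where the intermediate value theorem needs a small value.\<close>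

lemma smooth_ccdh_max_deg:
  assumes "finite (pverts H)"
  shows "smooth_ccdh H (real (max_deg H) + 1) = 0"
proof -
  have "real (deg H v) \<le> real (max_deg H)" if "v \<in> pverts H" for v
    using deg_le_max_deg[OF assms that] by simp
  then show ?thesis
    unfolding smooth_ccdh_conv_sum[OF assms, of "real (max_deg H) + 1", simplified]
    by (intro sum.neutral) force
qed

lemma smooth_ccdh_le:
  assumes "finite (pverts H)" "0 \<le> x"
    and "\<And>v. v \<in> pverts H \<Longrightarrow> deg H v < m"
  shows "smooth_ccdh H x \<le> real (card (pverts H)) * max 0 (min 1 (real m - x))"
proof -
  have "real (deg H v) + 1 \<le> real m" if "v \<in> pverts H" for v
    using assms(3)[OF that] by linarith
  then show ?thesis
    unfolding smooth_ccdh_conv_sum[OF assms(1,2)]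
    by (intro sum_bounded_above) force
qed

section \<open>The minimum is attained\<close>

text \<open>For each \<open>d\<close> a best \<open>d'\<close> exists by compactness, and only
  finitely many \<open>d\<close> occur. The admissible \<open>\<epsilon>\<close> therefore form a
  closed half-line, which has a least element.\<close>

lemma RH_within_threshold:
  fixes F :: "'a pair_pre_digraph" and G :: "'b pair_pre_digraph"
  assumes F: "finite (pverts F)" "pverts F \<noteq> {}" and G: "finite (pverts G)"
  obtains r where "\<And>\<epsilon>. 0 \<le> \<epsilon> \<and> RH_within F G \<epsilon> \<longleftrightarrow> r \<le> \<epsilon>"
proof -
  let ?I = "{1..real (max_deg G) + 1}"
  \<comment> \<open>For \<open>d\<close> in the range of \<open>F\<close>, this is the smallest
    \<open>\<epsilon>\<close> for which \<open>d'\<close> is a valid partner of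
    \<open>d\<close>.\<close>
  let ?g = "\<lambda>d d'. max (\<bar>real d - d'\<bar> / real d)
    (\<bar>smooth_ccdh F (real d) - smooth_ccdh G d'\<bar> / smooth_ccdh F (real d))"
  have "\<exists>x\<in>?I. \<forall>y\<in>?I. ?g d x \<le> ?g d y" for d
  proof -
    have "continuous_on ?I (smooth_ccdh G)"
      using continuous_on_smooth_ccdh[OF G] by (rule continuous_on_subset) auto
    then have "continuous_on ?I (?g d)"
      \<comment> \<open>Here \<open>d\<close> is arbitrary and the denominators may vanish;
        multiplying by a constant inverse is continuous regardless.\<close>
      unfolding divide_inverse by (intro continuous_intros)
    then show ?thesis
      by (intro continuous_attains_inf) auto
  qed
  then obtain p where p: "\<And>d. p d \<in> ?I" "\<And>d y. y \<in> ?I \<Longrightarrow> ?g d (p d) \<le> ?g d y"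
    by metis
  have g_le: "\<bar>real d - y\<bar> \<le> \<epsilon> * real d \<and>
      \<bar>smooth_ccdh F (real d) - smooth_ccdh G y\<bar> \<le> \<epsilon> * smooth_ccdh F (real d)
      \<longleftrightarrow> ?g d y \<le> \<epsilon>" if "d \<in> {1..max_deg F}" for d y \<epsilon>
  proof -
    have "0 < real d" "0 < real (ccdh F d)"
      using that ccdh_pos[OF F] by auto
    then show ?thesis by (simp add: pos_divide_le_eq)
  qed
  have within: "RH_within F G \<epsilon> \<longleftrightarrow> (\<forall>d\<in>{1..max_deg F}. ?g d (p d) \<le> \<epsilon>)" for \<epsilon>
  proof -
    have "(\<exists>y\<in>?I. ?g d y \<le> \<epsilon>) \<longleftrightarrow> ?g d (p d) \<le> \<epsilon>" for d
      using p order_trans by meson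
    then show ?thesis
      unfolding RH_within_def using g_le by (metis (no_types, lifting))
  qed
  show thesis
  proof (rule that)
    \<comment> \<open>The inserted 0 accounts for the condition \<open>0 \<le> \<epsilon>\<close>
      and keeps the set nonempty.\<close>
    show "0 \<le> \<epsilon> \<and> RH_within F G \<epsilon> \<longleftrightarrow> Max (insert 0 ((\<lambda>d. ?g d (p d)) ` {1..max_deg F})) \<le> \<epsilon>" for \<epsilon>
      unfolding within by (subst Max_le_iff) auto
  qed
qed

lemma
  assumes "finite (pverts F)" "pverts F \<noteq> {}" "finite (pverts G)"
  shows RH_dir_le_iff: "RH_dir F G \<le> \<epsilon> \<longleftrightarrow> 0 \<le> \<epsilon> \<and> RH_within F G \<epsilon>"
    and RH_within_RH_dir: "RH_within F G (RH_dir F G)"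
proof -
  obtain r where r: "\<And>\<epsilon>. 0 \<le> \<epsilon> \<and> RH_within F G \<epsilon> \<longleftrightarrow> r \<le> \<epsilon>"
    using RH_within_threshold assms by blast
  have "RH_dir F G = r"
    unfolding RH_dir_def r by (rule Least_equality) auto
  then show "RH_dir F G \<le> \<epsilon> \<longleftrightarrow> 0 \<le> \<epsilon> \<and> RH_within F G \<epsilon>" "RH_within F G (RH_dir F G)"
    using r by auto
qed

lemma graphs_on_nonempty:
  assumes "H \<in> graphs_on k" "2 \<le> k"
  shows "pverts H \<noteq> {}"
  using graphs_onD(2)[OF assms(1)] assms(2) by auto

lemma RH_dir_leI:
  assumes "F \<in> graphs_on k" "G \<in> graphs_on l" "2 \<le> k" "0 \<le> \<epsilon>" "RH_within F G \<epsilon>"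
  shows "RH_dir F G \<le> \<epsilon>"
  using assms RH_dir_le_iff[of F G] graphs_onD(1) graphs_on_nonempty by blast

lemma RH_within_RH_dir_graphs_on:
  assumes "F \<in> graphs_on k" "G \<in> graphs_on l" "2 \<le> k"
  shows "RH_within F G (RH_dir F G)"
  using assms by (intro RH_within_RH_dir graphs_on_nonempty[of F k]) (auto dest: graphs_onD(1))

section \<open>Complete graphs and stars\<close>

definition graph_of_rel :: "nat \<Rightarrow> (nat \<Rightarrow> nat \<Rightarrow> bool) \<Rightarrow> nat pair_pre_digraph" where
  "graph_of_rel k E = \<lparr>pverts = {..<k}, parcs = {(u, v). u < k \<and> v < k \<and> E u v}\<rparr>"

lemma deg_graph_of_rel: "v < k \<Longrightarrow> deg (graph_of_rel k E) v = card {w. w < k \<and> E v w}"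
  by (simp add: deg_conv_card graph_of_rel_def)

lemma graph_of_rel_in_graphs_on:
  assumes "\<And>u. \<not> E u u" "\<And>u v. E u v \<Longrightarrow> E v u"
    and "\<And>v. v < k \<Longrightarrow> \<exists>w<k. E v w"
  shows "graph_of_rel k E \<in> graphs_on k"
proof -
  let ?G = "graph_of_rel k E"
  have "finite (parcs ?G)"
    by (rule finite_subset[of _ "{..<k} \<times> {..<k}"]) (auto simp: graph_of_rel_def)
  then have "pair_graph ?G"
    using assms(1,2)
    by unfold_locales (auto simp: graph_of_rel_def symmetric_def sym_def)
  moreover have "deg ?G v \<noteq> 0" if "v < k" for v
    using assms(3)[OF that] by (auto simp: deg_graph_of_rel[OF that])
  ultimately show ?thesis
    by (auto simp: graphs_on_def) (auto simp: graph_of_rel_def)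
qed

definition complete_graph :: "nat \<Rightarrow> nat pair_pre_digraph" where
  "complete_graph k = graph_of_rel k (\<noteq>)"

definition star_graph :: "nat \<Rightarrow> nat pair_pre_digraph" where
  "star_graph k = graph_of_rel k (\<lambda>u v. u \<noteq> v \<and> (u = 0 \<or> v = 0))"

lemma complete_graph_in_graphs_on:
  assumes "2 \<le> k" shows "complete_graph k \<in> graphs_on k"
  unfolding complete_graph_def
proof (rule graph_of_rel_in_graphs_on)
  show "\<exists>w<k. v \<noteq> w" for v
    using assms by (intro exI[of _ "if v = 0 then 1 else 0"]) auto
qed auto

lemma star_graph_in_graphs_on:
  assumes "2 \<le> k" shows "star_graph k \<in> graphs_on k"
  unfolding star_graph_def
proof (rule graph_of_rel_in_graphs_on)
  show "\<exists>w<k. v \<noteq> w \<and> (v = 0 \<or> w = 0)" for v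
    using assms by (intro exI[of _ "if v = 0 then 1 else 0"]) auto
qed auto

text \<open>All degrees equal k - 1, so the k ramps coincide.\<close>

lemma smooth_ccdh_complete_graph:
  assumes "0 \<le> x"
  shows "smooth_ccdh (complete_graph k) x = real k * max 0 (min 1 (real k - x))"
proof -
  have V: "pverts (complete_graph k) = {..<k}"
    by (simp add: complete_graph_def graph_of_rel_def)
  have "real (deg (complete_graph k) v) + 1 = real k" if "v < k" for v
  proof -
    have "{w. w < k \<and> v \<noteq> w} = {..<k} - {v}" by auto
    then show ?thesis
      using that by (simp add: complete_graph_def deg_graph_of_rel)
  qed
  then show ?thesis using assms by (simp add: smooth_ccdh_conv_sum V)
qed

lemma max_deg_complete_graph_le: "2 \<le> k \<Longrightarrow> real (max_deg (complete_graph k)) + 1 \<le> real k"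
  using max_deg_graphs_on(2)[OF complete_graph_in_graphs_on] by fastforce

lemma
  assumes "3 \<le> k"
  shows ccdh_star_graph: "ccdh (star_graph k) 2 = 1"
    and max_deg_star_graph: "2 \<le> max_deg (star_graph k)"
proof -
  have V: "pverts (star_graph k) = {..<k}"
    by (simp add: star_graph_def graph_of_rel_def)
  have "{w. w < k \<and> 0 \<noteq> w \<and> (0 = (0::nat) \<or> w = 0)} = {..<k} - {0}" by auto
  then have d0: "deg (star_graph k) 0 = k - 1"
    using assms by (simp add: star_graph_def deg_graph_of_rel)
  have "deg (star_graph k) v = 1" if "v < k" "v \<noteq> 0" for v
  proof -
    have "{w. w < k \<and> v \<noteq> w \<and> (v = 0 \<or> w = 0)} = {0}" using that by auto
    then show ?thesis using that by (simp add: star_graph_def deg_graph_of_rel)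
  qed
  then have "{v \<in> pverts (star_graph k). 2 \<le> deg (star_graph k) v} = {0}"
    unfolding V using d0 assms by (auto, force)
  then show "ccdh (star_graph k) 2 = 1" by (simp add: ccdh_def)
  show "2 \<le> max_deg (star_graph k)"
    using deg_le_max_deg[of "star_graph k" 0] d0 assms V by simp
qed

section \<open>Distance to the complete graph\<close>

text \<open>Source of both lower bounds. A partner \<open>d'\<close> of \<open>d\<close> lies either
  on the plateau of height m, up to m - 1, or on the final descent, where the smooth ccdh is m(m -
  d').\<close>

lemma RH_within_complete_graphD:
  assumes "RH_within F (complete_graph m) \<epsilon>" "d \<in> {1..max_deg F}" "2 \<le> m"
  shows "real m \<le> (1 + \<epsilon>) * real (ccdh F d) \<or>
    (real m - 1 \<le> (1 + \<epsilon>) * real d \<and>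
     (real m)\<^sup>2 \<le> (1 + \<epsilon>) * (real (ccdh F d) + real m * real d))"
proof -
  obtain d' where d': "1 \<le> d'" "d' \<le> real (max_deg (complete_graph m)) + 1"
    and le: "\<bar>real d - d'\<bar> \<le> \<epsilon> * real d"
      "\<bar>real (ccdh F d) - smooth_ccdh (complete_graph m) d'\<bar> \<le> \<epsilon> * real (ccdh F d)"
    using assms(1,2) unfolding RH_within_def by fastforce
  have "d' \<le> real m" using d'(2) max_deg_complete_graph_le[OF assms(3)] by linarith
  have phi: "real m * max 0 (min 1 (real m - d')) \<le> (1 + \<epsilon>) * real (ccdh F d)"
    using le(2) d'(1) smooth_ccdh_complete_graph[of d' m] by (simp add: algebra_simps)
  have dd: "d' \<le> (1 + \<epsilon>) * real d" using le(1) by (simp add: algebra_simps)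
  show ?thesis
  proof (cases "d' \<le> real m - 1")
    case True
    then show ?thesis using phi by simp
  next
    case False
    then have "real m * (real m - d') \<le> (1 + \<epsilon>) * real (ccdh F d)"
      using phi \<open>d' \<le> real m\<close> by simp
    moreover have "real m * d' \<le> real m * ((1 + \<epsilon>) * real d)"
      using dd by (intro mult_left_mono) auto
    \<comment> \<open>Adding the two inequalities cancels the unknown \<open>m * d'\<close>.\<close>
    ultimately have "(real m)\<^sup>2 \<le> (1 + \<epsilon>) * (real (ccdh F d) + real m * real d)"
      by (simp add: algebra_simps power2_eq_square)
    then show ?thesis using False dd by linarith
  qed
qed

section \<open>Graphs with at least three vertices\<close>

text \<open>With c = 1 + \<epsilon>, the goal is to find \<open>d'\<close> with (2 - c) d \<le> d'
  \<le> c d and smooth ccdh of \<open>G\<close> between (2 - c) a and c a. The sizes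
  \<open>k\<close> and \<open>l\<close> are not ordered, so the lemma serves both directions of the
  distance.\<close>

lemma RH_within_extremal:
  assumes F: "F \<in> graphs_on k" and G: "G \<in> graphs_on l"
    and k: "3 \<le> k" "k \<le> m" and l: "3 \<le> l" "l \<le> m" and m: "4 \<le> m"
  shows "RH_within F G ((real m)\<^sup>2 / (2 * real m + 1) - 1)"
  unfolding RH_within_def
proof
  fix d assume d: "d \<in> {1..max_deg F}"
  define c where "c = (real m)\<^sup>2 / (2 * real m + 1)"
  define a where "a = real (ccdh F d)"
  have c: "c * (2 * real m + 1) = (real m)\<^sup>2" by (simp add: c_def)
  then have cm: "real m * (real m - 2 * c) = c" by (simp add: algebra_simps power2_eq_square)
  have "real m * (3 * real m) \<ge> real m * (2 * real m + 1)"
    using m by (intro mult_left_mono) auto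
  then have c3: "real m \<le> 3 * c" by (simp add: c_def field_simps power2_eq_square)
  have c1: "1 \<le> c" using c3 m by linarith
  \<comment> \<open>This makes both lower limits at most 1. For m = 4, c = 16/9 and the product is
    8/9; from m = 5 on, c is at least 2 and the product is not positive.\<close>
  have low: "(2 - c) * real m \<le> 1"
  proof (cases "m = 4")
    case True
    then show ?thesis by (simp add: c_def)
  next
    case False
    then have m5: "5 \<le> real m" using m by simp
    then have "2 * (2 * real m + 1) \<le> 5 * real m" by argo
    also have "\<dots> \<le> (real m)\<^sup>2"
      unfolding power2_eq_square using m5 by (intro mult_right_mono) auto
    finally have "2 * (2 * real m + 1) \<le> (real m)\<^sup>2" .
    then have "2 \<le> c" by (simp add: c_def pos_le_divide_eq)
    then have "(2 - c) * real m \<le> 0" by (simp add: mult_nonpos_nonneg)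
    then show ?thesis by simp
  qed
  have lowb: "(2 - c) * x \<le> 1" if "0 \<le> x" "x \<le> real m" for x
  proof (cases "2 \<le> c")
    case True
    then have "(2 - c) * x \<le> 0" using that by (simp add: mult_nonpos_nonneg)
    then show ?thesis by simp
  next
    case False
    then have "(2 - c) * x \<le> (2 - c) * real m" using that by (intro mult_left_mono) auto
    then show ?thesis using low by simp
  qed
  have finF: "finite (pverts F)" and finG: "finite (pverts G)"
    using F G graphs_onD(1) by blast+
  have "0 < ccdh F d"
    using ccdh_pos[OF finF] graphs_on_nonempty[OF F] k d by simp
  then have a1: "1 \<le> a" by (simp add: a_def)
  have am: "a \<le> real m"
    using ccdh_le_card[OF finF, of d] graphs_onD(2)[OF F] k by (simp add: a_def)
  have d1: "1 \<le> real d" and dm: "real d \<le> real m"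
    using d max_deg_graphs_on(2)[OF F] k by auto
  have cd: "1 \<le> c * real d" using mult_mono[OF c1 d1] c1 by simp
  have ca: "c \<le> c * a" using mult_left_mono[OF a1, of c] c1 by simp
  have bound: "smooth_ccdh G (c * real d) \<le> c * a"
  proof -
    have "deg G v < m" if "v \<in> pverts G" for v
      using graphs_onD(4)[OF G that] l by simp
    then have "smooth_ccdh G (c * real d) \<le> real l * max 0 (min 1 (real m - c * real d))"
      using smooth_ccdh_le[OF finG, of "c * real d" m] cd graphs_onD(2)[OF G] by simp
    also have "\<dots> \<le> real m * max 0 (min 1 (real m - c * real d))"
      using l by (intro mult_right_mono) auto
    also have "\<dots> \<le> c * a"
    proof (cases "3 \<le> a")
      case True
      have "real m * max 0 (min 1 (real m - c * real d)) \<le> real m * 1"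
        by (intro mult_left_mono) auto
      also have "\<dots> \<le> c * 3" using c3 by simp
      also have "\<dots> \<le> c * a" using True c1 by (intro mult_left_mono) auto
      finally show ?thesis .
    next
      case False
      \<comment> \<open>At d = 1 all k \<ge> 3 vertices are counted, so a would be at least
        3.\<close>
      then have "d \<noteq> 1" using ccdh_one[OF F] k by (auto simp: a_def)
      then have "2 \<le> real d" using d by auto
      then have "2 * c \<le> c * real d" using mult_left_mono[of 2 "real d" c] c1 by simp
      \<comment> \<open>Nonnegativity lets the clamped term be bounded by m - 2c itself; it follows
        from \<open>cm\<close>, as c is positive.\<close>
      moreover have "0 \<le> real m - 2 * c"
      proof (rule ccontr)
        assume "\<not> 0 \<le> real m - 2 * c"
        then have "real m * (real m - 2 * c) \<le> 0" by (simp add: mult_nonneg_nonpos)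
        then show False using cm c1 by simp
      qed
      ultimately have "real m * max 0 (min 1 (real m - c * real d)) \<le> real m * (real m - 2 * c)"
        by (intro mult_left_mono) auto
      then show ?thesis using cm ca by simp
    qed
    finally show ?thesis .
  qed
  have phi1: "smooth_ccdh G 1 = real l"
    using smooth_ccdh_of_nat[of G 1] ccdh_one[OF G] by simp
  have "\<exists>d'\<in>{1..real (max_deg G) + 1}. d' \<le> c * real d \<and>
      smooth_ccdh G d' \<le> c * a \<and> (2 - c) * a \<le> smooth_ccdh G d'"
  proof (cases "real l \<le> c * a")
    case True
    have "(2 - c) * a \<le> real l" using lowb[of a] a1 am l by simp
    then show ?thesis using True cd phi1 by (intro bexI[of _ 1]) auto
  next
    case False
    \<comment> \<open>The partner must respect both upper limits. At either one the smooth ccdh of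
      \<open>G\<close> is at most c a, while at 1 it equals l > c a.\<close>
    define b where "b = min (c * real d) (real (max_deg G) + 1)"
    have b1: "1 \<le> b" using cd by (simp add: b_def)
    have "smooth_ccdh G b \<le> c * a"
      using bound smooth_ccdh_max_deg[OF finG] ca c1 by (auto simp: b_def min_def)
    moreover have "continuous_on {1..b} (smooth_ccdh G)"
      using continuous_on_smooth_ccdh[OF finG] by (rule continuous_on_subset) auto
    ultimately obtain x where x: "1 \<le> x" "x \<le> b" "smooth_ccdh G x = c * a"
      using IVT2'[of "smooth_ccdh G" b "c * a" 1] False phi1 b1 by auto
    have "(2 - c) * a \<le> c * a" using c1 a1 by (intro mult_right_mono) auto
    then show ?thesis using x by (intro bexI[of _ x]) (auto simp: b_def)
  qed
  then obtain d' where d': "d' \<in> {1..real (max_deg G) + 1}" "d' \<le> c * real d"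
      "smooth_ccdh G d' \<le> c * a" "(2 - c) * a \<le> smooth_ccdh G d'"
    by blast
  have "(2 - c) * real d \<le> d'" using lowb[of "real d"] d1 dm d'(1) by simp
  then have "\<bar>real d - d'\<bar> \<le> (c - 1) * real d"
    using d'(2) by (simp add: abs_le_iff algebra_simps)
  moreover have "\<bar>a - smooth_ccdh G d'\<bar> \<le> (c - 1) * a"
    using d'(3,4) by (simp add: abs_le_iff algebra_simps)
  ultimately show "\<exists>d'\<in>{1..real (max_deg G) + 1}.
      \<bar>real d - d'\<bar> \<le> ((real m)\<^sup>2 / (2 * real m + 1) - 1) * real d \<and>
      \<bar>smooth_ccdh F (real d) - smooth_ccdh G d'\<bar>
        \<le> ((real m)\<^sup>2 / (2 * real m + 1) - 1) * smooth_ccdh F (real d)"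
    using d'(1) unfolding c_def a_def by auto
qed

lemma extremal_nonneg:
  assumes "4 \<le> m" shows "0 \<le> (real m)\<^sup>2 / (2 * real m + 1) - 1"
proof -
  have "4 * real m \<le> (real m)\<^sup>2"
    unfolding power2_eq_square using assms by (intro mult_right_mono) auto
  then have "2 * real m + 1 \<le> (real m)\<^sup>2" using assms by linarith
  then show ?thesis by (simp add: pos_le_divide_eq)
qed

text \<open>Only the centre of the star has degree at least 2, so d = 2 has ccdh value 1. The
  descent alternative then reads m^2 \<le> (1 + \<epsilon>)(2m + 1), and the plateau alternative m
  \<le> 1 + \<epsilon> implies it.\<close>

lemma RH_dir_star_complete_ge:
  assumes "3 \<le> n" "2 \<le> m"
  shows "(real m)\<^sup>2 / (2 * real m + 1) - 1 \<le> RH_dir (star_graph n) (complete_graph m)"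
proof -
  define \<epsilon> where "\<epsilon> = RH_dir (star_graph n) (complete_graph m)"
  have "RH_within (star_graph n) (complete_graph m) \<epsilon>"
    unfolding \<epsilon>_def
    using RH_within_RH_dir_graphs_on[OF star_graph_in_graphs_on complete_graph_in_graphs_on] assms
    by simp
  then have "real m \<le> 1 + \<epsilon> \<or> (real m)\<^sup>2 \<le> (1 + \<epsilon>) * (1 + real m * 2)"
    using RH_within_complete_graphD[of "star_graph n" m \<epsilon> 2] assms max_deg_star_graph
    by (auto simp: ccdh_star_graph)
  then have "(real m)\<^sup>2 \<le> (1 + \<epsilon>) * (2 * real m + 1)"
  proof
    assume "real m \<le> 1 + \<epsilon>"
    then have "real m * real m \<le> (1 + \<epsilon>) * (2 * real m + 1)"
      by (intro mult_mono) auto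
    then show ?thesis by (simp add: power2_eq_square)
  qed (simp add: add.commute mult.commute)
  then have "(real m)\<^sup>2 / (2 * real m + 1) \<le> 1 + \<epsilon>"
    by (simp add: pos_divide_le_eq)
  then show ?thesis by (simp add: \<epsilon>_def)
qed

section \<open>The graph with two vertices\<close>

text \<open>Only d = 1 occurs. The partner 1 compares 2 with m, which is an error of exactly m/2 - 1
  relative to 2.\<close>

lemma RH_within_two_left:
  assumes F: "F \<in> graphs_on 2" and G: "G \<in> graphs_on m" and m: "2 \<le> m"
  shows "RH_within F G (real m / 2 - 1)"
  unfolding RH_within_def
proof
  fix d assume "d \<in> {1..max_deg F}"
  then have d: "d = 1" using max_deg_graphs_on(2)[OF F] by simp
  have "smooth_ccdh G 1 = real m" using smooth_ccdh_of_nat[of G 1] ccdh_one[OF G] by simp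
  then show "\<exists>d'\<in>{1..real (max_deg G) + 1}.
      \<bar>real d - d'\<bar> \<le> (real m / 2 - 1) * real d \<and>
      \<bar>smooth_ccdh F (real d) - smooth_ccdh G d'\<bar> \<le> (real m / 2 - 1) * smooth_ccdh F (real d)"
    using m ccdh_one[OF F] smooth_ccdh_of_nat[of F 1]
    by (intro bexI[of _ 1]) (auto simp: d)
qed

text \<open>For m \<ge> 4 the allowed error is at least 1, so the partner 2, where the smooth ccdh
  of \<open>F\<close> is 0, always works. The cases m = 2 and m = 3 are checked by hand.\<close>

lemma RH_within_two_right:
  assumes F: "F \<in> graphs_on 2" and G: "G \<in> graphs_on m" and m: "2 \<le> m"
  shows "RH_within G F (real m / 2 - 1)"
  unfolding RH_within_def
proof
  fix d assume d: "d \<in> {1..max_deg G}"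
  have finF: "finite (pverts F)" and finG: "finite (pverts G)"
    using F G graphs_onD(1) by blast+
  have maxF: "max_deg F = 1" using max_deg_graphs_on[OF F] by simp
  have "deg F v = 1" if "v \<in> pverts F" for v
    using graphs_onD(3,4)[OF F that] by simp
  then have phi: "smooth_ccdh F x = 2 * max 0 (min 1 (2 - x))" if "0 \<le> x" for x
    using that graphs_onD(2)[OF F] by (simp add: smooth_ccdh_conv_sum[OF finF])
  have a: "1 \<le> ccdh G d" "ccdh G d \<le> m"
    using ccdh_pos[OF finG graphs_on_nonempty[OF G m], of d] d
      ccdh_le_card[OF finG, of d] graphs_onD(2)[OF G] by auto
  have dm: "1 \<le> d" "d < m" using d max_deg_graphs_on(2)[OF G m] by auto
  have "\<exists>d'\<in>{1..2}. \<bar>real d - d'\<bar> \<le> (real m / 2 - 1) * real d \<and>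
      \<bar>real (ccdh G d) - smooth_ccdh F d'\<bar> \<le> (real m / 2 - 1) * real (ccdh G d)"
  proof -
    consider "m = 2" | "m = 3" "d = 1" | "m = 3" "d = 2" | "4 \<le> m"
      using m dm by linarith
    then show ?thesis
    proof cases
      case 1
      then have "d = 1" using dm by simp
      then show ?thesis using 1 ccdh_one[OF G] phi by (intro bexI[of _ 1]) auto
    next
      case 2
      then show ?thesis using ccdh_one[OF G] phi by (intro bexI[of _ 1]) auto
    next
      case 3
      consider "ccdh G d = 1" | "ccdh G d = 2" | "ccdh G d = 3"
        using a 3 by linarith
      then show ?thesis
      proof cases
        case 1
        \<comment> \<open>At 3/2 the smooth ccdh of \<open>F\<close> is exactly 1, and the
          horizontal error 1/2 is below the allowed (1/2) * 2.\<close>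
        then show ?thesis using 3 phi by (intro bexI[of _ "3/2"]) auto
      qed (use 3 phi in \<open>intro bexI[of _ 1]; auto\<close>)+
    next
      case 4
      then have "1 * real d \<le> (real m / 2 - 1) * real d"
        "1 * real (ccdh G d) \<le> (real m / 2 - 1) * real (ccdh G d)"
        by (intro mult_right_mono; simp)+
      moreover have "\<bar>real d - 2\<bar> \<le> real d" using dm by auto
      ultimately show ?thesis using phi by (intro bexI[of _ 2]) auto
    qed
  qed
  then show "\<exists>d'\<in>{1..real (max_deg F) + 1}.
      \<bar>real d - d'\<bar> \<le> (real m / 2 - 1) * real d \<and>
      \<bar>smooth_ccdh G (real d) - smooth_ccdh F d'\<bar> \<le> (real m / 2 - 1) * smooth_ccdh G (real d)"
    by (simp add: maxF)
qed

text \<open>At d = 1 the ccdh value is 2. The plateau gives \<epsilon> \<ge> m/2 - 1, the descent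
  the stronger \<epsilon> \<ge> m - 2.\<close>

lemma RH_dir_two_complete_ge:
  assumes F: "F \<in> graphs_on 2" and m: "2 \<le> m"
  shows "real m / 2 - 1 \<le> RH_dir F (complete_graph m)"
proof -
  define \<epsilon> where "\<epsilon> = RH_dir F (complete_graph m)"
  have "RH_within F (complete_graph m) \<epsilon>"
    unfolding \<epsilon>_def
    using RH_within_RH_dir_graphs_on[OF F complete_graph_in_graphs_on[OF m]] by simp
  then have "real m \<le> (1 + \<epsilon>) * 2 \<or> real m - 1 \<le> 1 + \<epsilon>"
    using RH_within_complete_graphD[of F m \<epsilon> 1] m max_deg_graphs_on(1)[OF F] ccdh_one[OF F]
    by auto
  then show ?thesis using m by (auto simp: \<epsilon>_def)
qed

section \<open>Combining upper and lower bounds into the two maxima\<close>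

theorem theorem5p1:
  fixes n m :: nat
  assumes "2 \<le> n" and "n \<le> m"
  shows "(n = 2 \<longrightarrow>
            is_maximum {RH F G | F G. F \<in> graphs_on n \<and> G \<in> graphs_on m}
              (real m / 2 - 1)) \<and>
         (n \<ge> 3 \<and> m \<ge> 4 \<longrightarrow>
            is_maximum {RH F G | F G. F \<in> graphs_on n \<and> G \<in> graphs_on m}
              ((real m)\<^sup>2 / (2 * real m + 1) - 1))"
proof -
  \<comment> \<open>Both cases share this scheme: a uniform bound in both directions, attained by
    one \<open>F0\<close> against the complete graph, for which a lower bound in a single direction
    suffices.\<close>
  have max: "is_maximum {RH F G | F G. F \<in> graphs_on n \<and> G \<in> graphs_on m} r"
    if upper: "\<And>F G. F \<in> graphs_on n \<Longrightarrow> G \<in> graphs_on m \<Longrightarrow> RH_within F G r \<and> RH_within G F r"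
      and r: "0 \<le> r" and F0: "F0 \<in> graphs_on n"
      and lower: "r \<le> RH_dir F0 (complete_graph m)" for r F0
  proof -
    have le: "RH F G \<le> r" if "F \<in> graphs_on n" "G \<in> graphs_on m" for F G
      using that upper r assms by (auto simp: RH_def intro!: RH_dir_leI)
    have K: "complete_graph m \<in> graphs_on m" using complete_graph_in_graphs_on assms by simp
    have "RH F0 (complete_graph m) = r"
      using le[OF F0 K] lower by (simp add: RH_def)
    then show ?thesis unfolding is_maximum_def using le F0 K by blast
  qed
  have m: "2 \<le> m" using assms by simp
  show ?thesis
  proof (intro conjI impI)
    assume n: "n = 2"
    show "is_maximum {RH F G | F G. F \<in> graphs_on n \<and> G \<in> graphs_on m} (real m / 2 - 1)"
      using n m RH_within_two_left RH_within_two_right RH_dir_two_complete_ge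
      by (intro max[of _ "complete_graph 2"]) (auto simp: complete_graph_in_graphs_on)
  next
    assume n: "n \<ge> 3 \<and> m \<ge> 4"
    show "is_maximum {RH F G | F G. F \<in> graphs_on n \<and> G \<in> graphs_on m}
        ((real m)\<^sup>2 / (2 * real m + 1) - 1)"
    proof (rule max)
      show "star_graph n \<in> graphs_on n" using star_graph_in_graphs_on assms by simp
      show "(real m)\<^sup>2 / (2 * real m + 1) - 1 \<le> RH_dir (star_graph n) (complete_graph m)"
        using RH_dir_star_complete_ge n m by blast
      show "0 \<le> (real m)\<^sup>2 / (2 * real m + 1) - 1" using extremal_nonneg n by blast
      show "RH_within F G ((real m)\<^sup>2 / (2 * real m + 1) - 1) \<and>
          RH_within G F ((real m)\<^sup>2 / (2 * real m + 1) - 1)"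
        if "F \<in> graphs_on n" "G \<in> graphs_on m" for F G
        using RH_within_extremal[OF that] RH_within_extremal[OF that(2,1)] n assms by simp
    qed
  qed
qed

end
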